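(* Let $X$ be a finite non-empty set with $N$ elements, let $\tau\in\mathcal{M}_{\geq1}(X)$ have size $L=\|\tau\|$, and let $\upsilon\in\mathcal{M}(X)$ satisfy $\upsilon\geq\tau$. Then $$\mathrm{supp}\Big(\mathrm{HG}^{L-N+1}(\upsilon,\tau)\Big)\subseteq X\qquad\text{and}\qquad\mathrm{HG}^{L-N+1}(\upsilon,\tau)=\mathrm{hgff}(\upsilon,\tau).$$ As a result, $\mathrm{hgff}(\upsilon,\tau)$ is a probability distribution on $X$, that is, $\sum_{x\in X}\mathrm{hgff}(\upsilon,\tau)(x)=1$.
   Context: Multisets. A multiset over $X$ is a function $\varphi\colon X\to\mathbb{N}$ with finite support; $\mathcal{M}(X)$ is the set of multisets over $X$; $\|\varphi\|=\sum_x\varphi(x)$. Multisets are added, subtracted and ordered ($\leq$) pointwise; $\varphi\leq_K\psi$ means $\varphi\leq\psi$ and $\|\varphi\|=K$; $1|x\rangle$ is the multiset with value $1$ at $x$ and $0$ elsewhere; $\mathbf{1}=\sum_{x\in X}1|x\rangle$. $\mathcal{M}_{\geq1}(X)=\{\tau\in\mathcal{M}(X)\mid\tau\geq\mathbf{1}\}$ and $\mathcal{M}_{\geq\geq1}(X)=\{(\upsilon,\tau)\in\mathcal{M}(X)\times\mathcal{M}(X)\mid\upsilon\geq\tau\geq\mathbf{1}\}$. Write $\varphi\prec\tau$ ("fully below") if $\varphi(x)<\tau(x)$ for all $x\in X$. Distributions. $\mathcal{D}(A)$ is the set of functions $\omega\colon A\to[0,1]$ with finite support $\mathrm{supp}(\omega)=\{a\mid\omega(a)>0\}$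 and $\sum_a\omega(a)=1$, also written as formal convex sums $\sum_i r_i|a_i\rangle$. For a non-empty multiset $\varphi$, $\mathrm{Flrn}(\varphi)\in\mathcal{D}(X)$ is the normalisation $\mathrm{Flrn}(\varphi)(x)=\varphi(x)/\|\varphi\|$. Hypergeometric distribution. For $\upsilon\in\mathcal{M}(X)$ and $\varphi\leq_K\upsilon$, $\mathrm{hg}[K](\upsilon)(\varphi)=\prod_{x}\binom{\upsilon(x)}{\varphi(x)}\big/\binom{\|\upsilon\|}{K}$. When $[K]$ is omitted, $K=\|\varphi\|$. Hypergeometric first-full. For $\upsilon\geq\tau\geq\mathbf{1}$ and $x\in X$, $$\mathrm{hgff}(\upsilon,\tau)(x)=\sum_{\varphi\prec\tau,\ \varphi(x)=\tau(x)-1}\mathrm{hg}(\upsilon)(\varphi)\cdot\mathrm{Flrn}(\upsilon-\varphi)(x).$$ Markov models with output. For a function $c\colon Y\to\mathcal{D}(Y+X)$, with $Y+X$ the disjoint union, the iterates $c^n\colon Y\to\mathcal{D}(Y+X)$, $n\in\mathbb{N}$, are given by $c^0(y)=1|y\rangle$ and $$c^{n+1}(y)=\sum_{z\in Y+X}\Big(\sum_{y'\in Y}c(y)(y')\cdot c^n(y')(z)\Big)|z\rangle+\sum_{x\in X}c(y)(x)|x\rangle.$$ The hypergeometric model $\mathrm{HG}\colon\mathcal{M}_{\geq\geq1}(X)\to\mathcal{D}(\mathcal{M}_{\geq\geq1}(X)+X)$ is $$\mathrm{HG}(\upsilon,\tau)=\sum_{x,\,\tau(x)>1}\mathrm{Flrn}(\upsilon)(x)\,\big|\upsilon-1|x\rangle,\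 \tau-1|x\rangle\big\rangle+\sum_{x,\,\tau(x)=1}\mathrm{Flrn}(\upsilon)(x)\,|x\rangle.$$ A distribution on $\mathcal{M}_{\geq\geq1}(X)+X$ whose support is contained in the summand $X$ is identified with a distribution on $X$. *)

theory Defs
  imports "HOL-Probability.Probability"
begin

text \<open>
  The finite non-empty set \<open>X\<close> is the universe of a type of class \<open>finite\<close>.  Multisets over it are
  library multisets: the pointwise order is \<open>\<subseteq>#\<close>, the size is \<^const>\<open>size\<close>, and
  \<open>1|x\<rangle>\<close> is \<open>{#x#}\<close>.  A distribution is a \<^const>\<open>pmf\<close>, its support is \<^const>\<open>set_pmf\<close>;
  the library only demands countable support, but the distributions occurring below have finite
  support (\<open>finite_set_pmf_HG_iter\<close>).  The distribution \<open>Flrn \<phi>\<close> is \<^const>\<open>pmf_of_multiset\<close>.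
\<close>

definition ones :: "'a::finite multiset" where
  "ones = mset_set UNIV"

definition M_ge1 :: "'a::finite multiset set" where
  "M_ge1 = {\<tau>. ones \<subseteq># \<tau>}"

definition M_gege1 :: "('a::finite multiset \<times> 'a multiset) set" where
  "M_gege1 = {(\<upsilon>, \<tau>). \<tau> \<subseteq># \<upsilon> \<and> ones \<subseteq># \<tau>}"

definition fully_below :: "'a::finite multiset \<Rightarrow> 'a multiset \<Rightarrow> bool" where
  "fully_below \<phi> \<tau> \<longleftrightarrow> (\<forall>x. count \<phi> x < count \<tau> x)"

definition hg :: "nat \<Rightarrow> 'a::finite multiset \<Rightarrow> 'a multiset \<Rightarrow> real" where
  "hg K \<upsilon> \<phi> =
     (if \<phi> \<subseteq># \<upsilon> \<and> size \<phi> = K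
      then (\<Prod>x\<in>UNIV. real (count \<upsilon> x choose count \<phi> x)) / real (size \<upsilon> choose K)
      else 0)"

definition hgff :: "'a::finite multiset \<Rightarrow> 'a multiset \<Rightarrow> 'a \<Rightarrow> real" where
  "hgff \<upsilon> \<tau> x =
     (\<Sum>\<phi> | fully_below \<phi> \<tau> \<and> count \<phi> x = count \<tau> x - 1.
        hg (size \<phi>) \<upsilon> \<phi> * pmf (pmf_of_multiset (\<upsilon> - \<phi>)) x)"

text \<open>
  Iterates of a Markov model with output: the process stops once an output in the right summand has
  been produced.  The lemma \<open>pmf_markov_iter_Suc\<close> gives the corresponding sum formula.
\<close>

primrec markov_iter :: "('y \<Rightarrow> ('y + 'x) pmf) \<Rightarrow> nat \<Rightarrow> 'y \<Rightarrow> ('y + 'x) pmf" where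
  "markov_iter c 0 y = return_pmf (Inl y)"
| "markov_iter c (Suc n) y =
     bind_pmf (c y) (case_sum (markov_iter c n) (\<lambda>x. return_pmf (Inr x)))"

text \<open>
  The hypergeometric model.  It is meaningful on \<open>M_gege1\<close> only, where \<open>\<upsilon>\<close> is non-empty and the
  second branch means \<open>count \<tau> x = 1\<close>.  The model does not leave this set (\<open>HG_closed\<close>), and its
  probabilities are the coefficients of the expected formal convex sum (\<open>pmf_HG\<close>).
\<close>

definition HG :: "'a::finite multiset \<times> 'a multiset \<Rightarrow>
    (('a multiset \<times> 'a multiset) + 'a) pmf" where
  "HG = (\<lambda>(\<upsilon>, \<tau>).
     map_pmf (\<lambda>x. if count \<tau> x > 1 then Inl (\<upsilon> - {#x#}, \<tau> - {#x#}) else Inr x)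
       (pmf_of_multiset \<upsilon>))"

lemma ones_subseteq_iff: "ones \<subseteq># \<tau> \<longleftrightarrow> (\<forall>x. count \<tau> x \<ge> 1)"
  by (simp add: ones_def subseteq_mset_def)

lemma finite_fully_below:
  fixes \<tau> :: "'a::finite multiset"
  shows "finite {\<phi>. fully_below \<phi> \<tau> \<and> P \<phi>}"
proof (rule finite_imageD[where f = count])
  have "count ` {\<phi>. fully_below \<phi> \<tau> \<and> P \<phi>} \<subseteq> Pi\<^sub>E UNIV (\<lambda>x. {..<count \<tau> x})"
    by (auto simp: fully_below_def PiE_def)
  then show "finite (count ` {\<phi>. fully_below \<phi> \<tau> \<and> P \<phi>})"
    by (rule finite_subset) (intro finite_PiE, simp_all)
qed (simp add: inj_on_def count_inject)

lemma pmf_markov_iter_Suc: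
  fixes c :: "'y \<Rightarrow> ('y + 'x) pmf"
  assumes fin: "finite (set_pmf (c y))"
  shows "pmf (markov_iter c (Suc n) y) z =
    (\<Sum>y' | Inl y' \<in> set_pmf (c y). pmf (c y) (Inl y') * pmf (markov_iter c n y') z) +
    (\<Sum>x | Inr x \<in> set_pmf (c y). pmf (c y) (Inr x) * of_bool (z = Inr x))"
proof -
  let ?k = "case_sum (markov_iter c n) (\<lambda>x. return_pmf (Inr x))"
  let ?A = "{y'. Inl y' \<in> set_pmf (c y)}" and ?B = "{x. Inr x \<in> set_pmf (c y)}"
  have split: "set_pmf (c y) = Inl ` ?A \<union> Inr ` ?B"
  proof (rule set_eqI)
    fix w show "w \<in> set_pmf (c y) \<longleftrightarrow> w \<in> Inl ` ?A \<union> Inr ` ?B" by (cases w) auto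
  qed
  have finA: "finite ?A" and finB: "finite ?B"
    using finite_vimageI[OF fin, of Inl] finite_vimageI[OF fin, of Inr] by (auto simp: vimage_def)
  have "pmf (markov_iter c (Suc n) y) z = (\<Sum>w\<in>set_pmf (c y). pmf (c y) w * pmf (?k w) z)"
    by (simp add: pmf_bind integral_measure_pmf_real[OF fin] mult.commute)
  also have "\<dots> = (\<Sum>w\<in>Inl ` ?A. pmf (c y) w * pmf (?k w) z) +
      (\<Sum>w\<in>Inr ` ?B. pmf (c y) w * pmf (?k w) z)"
    by (subst split, rule sum.union_disjoint) (use finA finB in auto)
  also have "\<dots> = (\<Sum>y'\<in>?A. pmf (c y) (Inl y') * pmf (markov_iter c n y') z) +
      (\<Sum>x\<in>?B. pmf (c y) (Inr x) * of_bool (z = Inr x))"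
    by (intro arg_cong2[where f = "(+)"])
       (auto simp: sum.reindex inj_on_def indicator_def intro!: sum.cong)
  finally show ?thesis .
qed

lemma pmf_HG:
  assumes "(\<upsilon>, \<tau>) \<in> M_gege1"
  shows "pmf (HG (\<upsilon>, \<tau>)) z =
    (\<Sum>x | count \<tau> x > 1.
       real (count \<upsilon> x) / real (size \<upsilon>) * of_bool (z = Inl (\<upsilon> - {#x#}, \<tau> - {#x#}))) +
    (\<Sum>x | count \<tau> x = 1. real (count \<upsilon> x) / real (size \<upsilon>) * of_bool (z = Inr x))"
proof -
  let ?f = "\<lambda>x. if count \<tau> x > 1 then Inl (\<upsilon> - {#x#}, \<tau> - {#x#}) else Inr x"
  let ?r = "\<lambda>x. real (count \<upsilon> x) / real (size \<upsilon>)"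
  have pos': "count \<tau> x \<ge> 1" for x
    using assms unfolding M_gege1_def ones_subseteq_iff by blast
  have pos: "count \<upsilon> x \<ge> 1" for x
    using assms by (intro order_trans[OF pos'[of x]]) (simp add: M_gege1_def subseteq_mset_def)
  have ne: "\<upsilon> \<noteq> {#}" using pos[of undefined] by auto
  have "pmf (HG (\<upsilon>, \<tau>)) z = (\<Sum>x\<in>UNIV. ?r x * of_bool (z = ?f x))"
    by (simp add: HG_def map_pmf_def pmf_bind integral_measure_pmf_real[where A = UNIV] ne
        indicator_def mult.commute eq_commute[of z])
  also have "(UNIV :: 'a set) = {x. count \<tau> x > 1} \<union> {x. count \<tau> x = 1}"
    using pos'[unfolded le_less] by (auto simp: eq_commute[of "Suc 0"])
  also have "(\<Sum>x\<in>{x. count \<tau> x > 1} \<union> {x. count \<tau> x = 1}. ?r x * of_bool (z = ?f x)) =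
      (\<Sum>x | count \<tau> x > 1. ?r x * of_bool (z = ?f x)) +
      (\<Sum>x | count \<tau> x = 1. ?r x * of_bool (z = ?f x))"
    by (rule sum.union_disjoint) auto
  finally show ?thesis by simp
qed

lemma HG_closed:
  assumes "p \<in> M_gege1" "Inl q \<in> set_pmf (HG p)"
  shows "q \<in> M_gege1"
proof -
  obtain \<upsilon> \<tau> where p: "p = (\<upsilon>, \<tau>)" by (cases p)
  from assms(2) obtain x where x: "count \<tau> x > 1" "q = (\<upsilon> - {#x#}, \<tau> - {#x#})"
    unfolding p HG_def by (auto split: if_splits)
  have "\<tau> \<subseteq># \<upsilon>" and "\<forall>y. count \<tau> y \<ge> 1"
    using assms(1) unfolding p M_gege1_def ones_subseteq_iff by auto
  then have "\<tau> - {#x#} \<subseteq># \<upsilon> - {#x#}" and "\<forall>y. count (\<tau> - {#x#}) y \<ge> 1"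
    using x(1) by (auto simp: subseteq_mset_def simp del: count_greater_eq_one_iff intro: diff_le_mono)
  then show ?thesis
    unfolding x(2) M_gege1_def ones_subseteq_iff by blast
qed

lemma finite_set_pmf_HG_iter: "finite (set_pmf (markov_iter HG n p))"
proof (induction n arbitrary: p)
  case (Suc n)
  have "finite (set_pmf (HG p))" by (cases p) (simp add: HG_def)
  then show ?case using Suc by (auto split: sum.split)
qed simp

end

theory Submission
  imports Defs
begin

text \<open>
  Conditioning on the first draw \<open>y\<close> gives \<open>hgff\<close> the one-step recursion of the iterates of \<open>HG\<close>:
  a non-empty multiset \<open>\<phi>\<close> drawn from \<open>\<upsilon>\<close> has \<open>y\<close> as its first element with probability
  \<open>\<phi>(y) / \<parallel>\<phi>\<parallel>\<close>, and what remains is a draw of \<open>\<phi> - 1|y\<rangle>\<close> from \<open>\<upsilon> - 1|y\<rangle>\<close>, with the same final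
  urn \<open>\<upsilon> - \<phi>\<close>.  Every step that does not stop removes one element from \<open>\<tau>\<close> but keeps
  \<open>\<tau> \<ge> 1\<close>, so the process has stopped after \<open>L - N + 1\<close> steps.
\<close>

lemma hg_empty: "hg 0 \<upsilon> {#} = 1"
  by (simp add: hg_def)

text \<open>The absorption identity
  \<open>(n + 1) * (n choose k) = (n + 1 choose k + 1) * (k + 1)\<close>, used once at
  \<open>y\<close> in the numerator and once for the sizes in the denominator; the factors away from
  \<open>y\<close> agree. Outside the range of \<open>hg\<close> both sides vanish.\<close>

lemma hg_add_mset:
  fixes \<upsilon> \<phi> :: "'a::finite multiset"
  shows "real (count (add_mset y \<phi>) y) / real (Suc k) * hg (Suc k) (add_mset y \<upsilon>) (add_mset y \<phi>) =
    real (count (add_mset y \<upsilon>) y) / real (size (add_mset y \<upsilon>)) * hg k \<upsilon> \<phi>"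
proof (cases "\<phi> \<subseteq># \<upsilon> \<and> size \<phi> = k")
  case True
  then have sub: "\<phi> \<subseteq># \<upsilon>" and k: "size \<phi> = k" by auto
  define P where "P = (\<Prod>x\<in>UNIV - {y}. real (count \<upsilon> x choose count \<phi> x))"
  define a where "a = real (count \<upsilon> y choose count \<phi> y)"
  define a' where "a' = real (Suc (count \<upsilon> y) choose Suc (count \<phi> y))"
  define b where "b = real (size \<upsilon> choose k)"
  define b' where "b' = real (Suc (size \<upsilon>) choose Suc k)"
  have "k \<le> size \<upsilon>" using sub k size_mset_mono by blast
  then have b: "b \<noteq> 0" "b' \<noteq> 0" by (simp_all add: b_def b'_def del: binomial_Suc_Suc)
  have eq_a: "real (Suc (count \<upsilon> y)) * a = a' * real (Suc (count \<phi> y))"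
    unfolding a_def a'_def of_nat_mult[symmetric] Suc_times_binomial_eq ..
  have eq_b: "real (Suc (size \<upsilon>)) * b = b' * real (Suc k)"
    unfolding b_def b'_def of_nat_mult[symmetric] Suc_times_binomial_eq ..
  have old: "hg k \<upsilon> \<phi> = a * P / b"
    using sub k by (simp add: hg_def P_def a_def b_def prod.remove[of UNIV y])
  have new: "hg (Suc k) (add_mset y \<upsilon>) (add_mset y \<phi>) = a' * P / b'"
    using sub k by (simp add: hg_def P_def a'_def b'_def prod.remove[of UNIV y] del: binomial_Suc_Suc)
  have "real (Suc (count \<phi> y)) / real (Suc k) * (a' * P / b') =
      (a' * real (Suc (count \<phi> y))) * P / (b' * real (Suc k))"
    by (simp add: mult_ac)
  also have "\<dots> = (real (Suc (count \<upsilon> y)) * a) * P / (real (Suc (size \<upsilon>)) * b)"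
    unfolding eq_a eq_b ..
  finally show ?thesis
    unfolding old new by simp
qed (auto simp: hg_def)

text \<open>The weights \<open>count \<phi> y / size \<phi>\<close> sum to 1, so they split
  \<open>hg\<close> into summands that \<open>hg_add_mset\<close> rewrites one by one.\<close>

lemma hg_first_draw:
  fixes \<upsilon> \<phi> :: "'a::finite multiset"
  assumes "\<phi> \<noteq> {#}" "\<phi> \<subseteq># \<upsilon>"
  shows "hg (size \<phi>) \<upsilon> \<phi> =
    (\<Sum>y\<in>set_mset \<phi>. real (count \<upsilon> y) / real (size \<upsilon>) *
       hg (size (\<phi> - {#y#})) (\<upsilon> - {#y#}) (\<phi> - {#y#}))"
proof -
  have "(\<Sum>y\<in>set_mset \<phi>. real (count \<phi> y) / real (size \<phi>)) = 1"
    unfolding sum_divide_distrib[symmetric] of_nat_sum[symmetric] size_multiset_overloaded_eq[symmetric]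
    using assms(1) by simp
  then have "hg (size \<phi>) \<upsilon> \<phi> =
      (\<Sum>y\<in>set_mset \<phi>. real (count \<phi> y) / real (size \<phi>) * hg (size \<phi>) \<upsilon> \<phi>)"
    by (simp only: sum_distrib_right[symmetric] mult_1)
  also have "\<dots> = (\<Sum>y\<in>set_mset \<phi>. real (count \<upsilon> y) / real (size \<upsilon>) *
       hg (size (\<phi> - {#y#})) (\<upsilon> - {#y#}) (\<phi> - {#y#}))"
  proof (rule sum.cong[OF refl])
    fix y assume y: "y \<in># \<phi>"
    obtain \<phi>' where \<phi>: "\<phi> = add_mset y \<phi>'" using multi_member_split[OF y] by blast
    obtain \<upsilon>' where \<upsilon>: "\<upsilon> = add_mset y \<upsilon>'"
      using multi_member_split[OF mset_subset_eqD[OF assms(2) y]] by blast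
    show "real (count \<phi> y) / real (size \<phi>) * hg (size \<phi>) \<upsilon> \<phi> =
        real (count \<upsilon> y) / real (size \<upsilon>) * hg (size (\<phi> - {#y#})) (\<upsilon> - {#y#}) (\<phi> - {#y#})"
      using hg_add_mset[of y \<phi>' "size \<phi>'" \<upsilon>'] by (simp add: \<phi> \<upsilon>)
  qed
  finally show ?thesis .
qed

lemma M_gege1_pos:
  assumes "(\<upsilon>, \<tau>) \<in> M_gege1"
  shows "1 \<le> count \<tau> x"
  using assms unfolding M_gege1_def ones_subseteq_iff by blast

text \<open>Only for non-empty \<upsilon> does \<open>pmf_of_multiset\<close> have the values count
  over size. Types are inhabited, so \<open>undefined\<close> can serve as an element of X.\<close>

lemma M_gege1_not_empty:
  assumes "(\<upsilon>, \<tau>) \<in> M_gege1"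
  shows "\<upsilon> \<noteq> {#}"
proof -
  have "1 \<le> count \<tau> undefined" by (rule M_gege1_pos[OF assms])
  then show ?thesis using assms by (auto simp: M_gege1_def)
qed

text \<open>The summand \<phi> = \<open>{#}\<close> is the case that the first draw already fills
  \<open>x\<close>; all other \<phi> are expanded by their first draw and regrouped by it.\<close>

lemma hgff_recursion:
  fixes \<upsilon> \<tau> :: "'a::finite multiset"
  assumes ge: "(\<upsilon>, \<tau>) \<in> M_gege1"
  shows "hgff \<upsilon> \<tau> x =
    (\<Sum>y | count \<tau> y > 1. real (count \<upsilon> y) / real (size \<upsilon>) * hgff (\<upsilon> - {#y#}) (\<tau> - {#y#}) x) +
    real (count \<upsilon> x) / real (size \<upsilon>) * of_bool (count \<tau> x = 1)"
proof -
  define T where "T = (\<lambda>\<upsilon> \<phi>. hg (size \<phi>) \<upsilon> \<phi> * pmf (pmf_of_multiset (\<upsilon> - \<phi>)) x)"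
  define F where "F = (\<lambda>\<tau>. {\<phi>. fully_below \<phi> \<tau> \<and> count \<phi> x = count \<tau> x - 1})"
  let ?r = "\<lambda>y. real (count \<upsilon> y) / real (size \<upsilon>)"
  have hgff_T: "hgff \<upsilon> \<tau> x = sum (T \<upsilon>) (F \<tau>)" for \<upsilon> \<tau>
    by (simp add: hgff_def T_def F_def)
  have finF: "finite (F \<tau>)" for \<tau>
    unfolding F_def by (rule finite_fully_below)
  have pos: "count \<tau> y \<ge> 1" for y by (rule M_gege1_pos[OF ge])
  have sub: "\<phi> \<subseteq># \<upsilon>" if "\<phi> \<in> F \<tau>" for \<phi>
  proof (rule subset_mset.order_trans[of _ \<tau>])
    show "\<phi> \<subseteq># \<tau>"
      using that by (auto simp: F_def fully_below_def subseteq_mset_def intro: less_imp_le)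
    show "\<tau> \<subseteq># \<upsilon>" using ge by (simp add: M_gege1_def)
  qed
  \<comment> \<open>Positivity of \<tau> makes \<open>{#}\<close> fully below it, and excludes
    \<open>count \<tau> x = 0\<close>, where truncated subtraction would also give 0.\<close>
  have empty: "{#} \<in> F \<tau> \<longleftrightarrow> count \<tau> x = 1"
    using pos by (auto simp: F_def fully_below_def Suc_le_eq le_antisym)
  have first: "T \<upsilon> \<phi> = (\<Sum>y\<in>set_mset \<phi>. ?r y * T (\<upsilon> - {#y#}) (\<phi> - {#y#}))"
    if "\<phi> \<in> F \<tau> - {{#}}" for \<phi>
  proof -
    \<comment> \<open>The final urn is unchanged, so the Flrn factor of \<open>T\<close> factors out
      of the first-draw sum.\<close>
    have "(\<upsilon> - {#y#}) - (\<phi> - {#y#}) = \<upsilon> - \<phi>" if "y \<in># \<phi>" for y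
      using multi_member_split[OF that] by auto
    with hg_first_draw[of \<phi> \<upsilon>] sub[of \<phi>] that show ?thesis
      by (simp add: T_def sum_distrib_right mult.assoc)
  qed
  \<comment> \<open>Both counts at \<open>y\<close> drop by one, which preserves the strict
    inequalities. For y = x the equation at \<open>x\<close> shifts correctly because
    \<open>count \<tau> y > 1\<close> keeps the subtractions from truncating.\<close>
  have bij: "bij_betw (\<lambda>\<phi>. \<phi> - {#y#}) {\<phi> \<in> F \<tau>. y \<in># \<phi>} (F (\<tau> - {#y#}))"
    if y: "count \<tau> y > 1" for y
  proof (rule bij_betwI[where g = "add_mset y"])
    show "(\<lambda>\<phi>. \<phi> - {#y#}) \<in> {\<phi> \<in> F \<tau>. y \<in># \<phi>} \<rightarrow> F (\<tau> - {#y#})"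
    proof (rule Pi_I)
      fix \<phi> assume "\<phi> \<in> {\<phi> \<in> F \<tau>. y \<in># \<phi>}"
      then have \<phi>: "\<And>z. count \<phi> z < count \<tau> z" "count \<phi> x = count \<tau> x - 1" "0 < count \<phi> y"
        by (auto simp: F_def fully_below_def)
      then show "\<phi> - {#y#} \<in> F (\<tau> - {#y#})"
        using y by (auto simp: F_def fully_below_def diff_less_mono)
    qed
    show "add_mset y \<in> F (\<tau> - {#y#}) \<rightarrow> {\<phi> \<in> F \<tau>. y \<in># \<phi>}"
    proof (rule Pi_I)
      fix \<phi> assume "\<phi> \<in> F (\<tau> - {#y#})"
      then have \<phi>: "\<And>z. count \<phi> z < count (\<tau> - {#y#}) z"
          "count \<phi> x = count (\<tau> - {#y#}) x - 1"
        by (auto simp: F_def fully_below_def)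
      have "count (add_mset y \<phi>) z < count \<tau> z" for z
        using \<phi>(1)[of z] by (auto split: if_splits)
      moreover have "count (add_mset y \<phi>) x = count \<tau> x - 1"
        using \<phi>(2) y by (auto split: if_splits)
      ultimately show "add_mset y \<phi> \<in> {\<phi> \<in> F \<tau>. y \<in># \<phi>}"
        by (auto simp: F_def fully_below_def)
    qed
  qed auto
  have below: "count \<tau> y > 1" if "\<phi> \<in> F \<tau>" "y \<in># \<phi>" for \<phi> y
  proof -
    have "count \<phi> y < count \<tau> y" "0 < count \<phi> y"
      using that by (auto simp: F_def fully_below_def)
    then show ?thesis by linarith
  qed
  have "hgff \<upsilon> \<tau> x = sum (T \<upsilon>) (F \<tau> - {{#}}) + sum (T \<upsilon>) (F \<tau> \<inter> {{#}})"
    unfolding hgff_T by (subst sum.Int_Diff[OF finF, of _ _ "{{#}}"]) simp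
  also have "sum (T \<upsilon>) (F \<tau> \<inter> {{#}}) = ?r x * of_bool (count \<tau> x = 1)"
    using empty M_gege1_not_empty[OF ge] by (auto simp: T_def hg_empty)
  also have "sum (T \<upsilon>) (F \<tau> - {{#}}) =
      (\<Sum>\<phi>\<in>F \<tau> - {{#}}. \<Sum>y\<in>set_mset \<phi>. ?r y * T (\<upsilon> - {#y#}) (\<phi> - {#y#}))"
    by (rule sum.cong[OF refl first])
  \<comment> \<open>Readmitting \<open>{#}\<close> adds an empty inner sum, and \<open>below\<close>
    bounds \<open>y\<close> independently of \<phi>; the two sums can then be exchanged.\<close>
  also have "\<dots> = (\<Sum>\<phi>\<in>F \<tau>. \<Sum>y | y \<in> {y. count \<tau> y > 1} \<and> y \<in># \<phi>.
      ?r y * T (\<upsilon> - {#y#}) (\<phi> - {#y#}))"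
    by (intro sum.mono_neutral_cong_left finF sum.cong ballI) (use below in auto)
  also have "\<dots> = (\<Sum>y | count \<tau> y > 1. \<Sum>\<phi> | \<phi> \<in> F \<tau> \<and> y \<in># \<phi>.
      ?r y * T (\<upsilon> - {#y#}) (\<phi> - {#y#}))"
    by (rule sum.swap_restrict[OF finF]) simp
  also have "\<dots> = (\<Sum>y | count \<tau> y > 1. ?r y * hgff (\<upsilon> - {#y#}) (\<tau> - {#y#}) x)"
  proof (rule sum.cong[OF refl])
    fix y assume "y \<in> {y. count \<tau> y > 1}"
    then show "(\<Sum>\<phi> | \<phi> \<in> F \<tau> \<and> y \<in># \<phi>. ?r y * T (\<upsilon> - {#y#}) (\<phi> - {#y#})) =
        ?r y * hgff (\<upsilon> - {#y#}) (\<tau> - {#y#}) x"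
      using sum.reindex_bij_betw[OF bij, of y "T (\<upsilon> - {#y#})"]
      by (simp only: mem_Collect_eq hgff_T sum_distrib_left[symmetric])
  qed
  finally show ?thesis .
qed

text \<open>The counterpart of \<open>hgff_recursion\<close>, in the same form. Unfolding
  \<open>HG\<close> as a draw from \<upsilon> indexes the sum by the drawn element instead of by the
  successor state.\<close>

lemma pmf_markov_iter_HG_Suc:
  fixes \<upsilon> \<tau> :: "'a::finite multiset"
  assumes "(\<upsilon>, \<tau>) \<in> M_gege1"
  shows "pmf (markov_iter HG (Suc n) (\<upsilon>, \<tau>)) (Inr x) =
    (\<Sum>y | count \<tau> y > 1. real (count \<upsilon> y) / real (size \<upsilon>) *
       pmf (markov_iter HG n (\<upsilon> - {#y#}, \<tau> - {#y#})) (Inr x)) +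
    real (count \<upsilon> x) / real (size \<upsilon>) * of_bool (count \<tau> x = 1)"
proof -
  let ?r = "\<lambda>y. real (count \<upsilon> y) / real (size \<upsilon>)"
  let ?k = "\<lambda>y. if count \<tau> y > 1 then markov_iter HG n (\<upsilon> - {#y#}, \<tau> - {#y#})
    else return_pmf (Inr y)"
  have "markov_iter HG (Suc n) (\<upsilon>, \<tau>) = bind_pmf (pmf_of_multiset \<upsilon>) ?k"
    by (auto simp: HG_def bind_map_pmf intro!: bind_pmf_cong)
  then have "pmf (markov_iter HG (Suc n) (\<upsilon>, \<tau>)) (Inr x) = (\<Sum>y\<in>UNIV. ?r y * pmf (?k y) (Inr x))"
    using M_gege1_not_empty[OF assms]
    by (simp add: pmf_bind integral_measure_pmf_real[where A = UNIV] mult.commute)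
  also have "\<dots> = (\<Sum>y | count \<tau> y > 1. ?r y * pmf (?k y) (Inr x)) +
      (\<Sum>y | \<not> count \<tau> y > 1. ?r y * pmf (?k y) (Inr x))"
    by (subst sum.union_disjoint[symmetric]) (auto intro: sum.cong)
  \<comment> \<open>These draws stop with output \<open>y\<close>, so only y = x
    contributes.\<close>
  also have "(\<Sum>y | \<not> count \<tau> y > 1. ?r y * pmf (?k y) (Inr x)) =
      (\<Sum>y | \<not> count \<tau> y > 1. if y = x then ?r x else 0)"
    by (intro sum.cong) auto
  also have "\<dots> = ?r x * of_bool (count \<tau> x = 1)"
    using M_gege1_pos[OF assms, of x] by (simp add: sum.delta' le_antisym)
  finally show ?thesis by simp
qed

text \<open>The induction step for the hypotheses of both inductions on \<open>n\<close> below, with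
  \<open>m\<close> as \<open>CARD('a)\<close>.\<close>

lemma markov_iter_HG_step:
  assumes "(\<upsilon>, \<tau>) \<in> M_gege1" "count \<tau> y > 1" "size \<tau> < m + Suc n"
  shows "(\<upsilon> - {#y#}, \<tau> - {#y#}) \<in> M_gege1" "size (\<tau> - {#y#}) < m + n"
proof -
  have y: "y \<in># \<tau>" using assms(2) by (metis count_inI not_less_zero)
  then have "y \<in># \<upsilon>" using assms(1) by (auto simp: M_gege1_def dest: mset_subset_eqD)
  then have "Inl (\<upsilon> - {#y#}, \<tau> - {#y#}) \<in> set_pmf (HG (\<upsilon>, \<tau>))"
    using assms(2) M_gege1_not_empty[OF assms(1)] by (auto simp: HG_def image_iff)
  then show "(\<upsilon> - {#y#}, \<tau> - {#y#}) \<in> M_gege1"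
    by (rule HG_closed[OF assms(1)])
  have "size \<tau> = Suc (size (\<tau> - {#y#}))"
    using y by (metis size_Suc_Diff1)
  then show "size (\<tau> - {#y#}) < m + n" using assms(3) by simp
qed

text \<open>Contradicts the size bound at n = 0, so both inductions have a vacuous base
  case.\<close>

lemma size_ge_card:
  fixes \<tau> :: "'a::finite multiset"
  assumes "(\<upsilon>, \<tau>) \<in> M_gege1"
  shows "CARD('a) \<le> size \<tau>"
  using assms size_mset_mono[of ones \<tau>] by (simp add: M_gege1_def ones_def)

lemma set_pmf_markov_iter_HG:
  fixes \<upsilon> \<tau> :: "'a::finite multiset"
  assumes "(\<upsilon>, \<tau>) \<in> M_gege1" "size \<tau> < CARD('a) + n"
  shows "set_pmf (markov_iter HG n (\<upsilon>, \<tau>)) \<subseteq> range Inr"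
  using assms
proof (induction n arbitrary: \<upsilon> \<tau>)
  case 0
  then show ?case using size_ge_card[OF 0(1)] by simp
next
  case (Suc n)
  have "set_pmf (markov_iter HG n (\<upsilon> - {#y#}, \<tau> - {#y#})) \<subseteq> range Inr" if "count \<tau> y > 1" for y
    by (rule Suc.IH[OF markov_iter_HG_step[OF Suc.prems(1) that Suc.prems(2)]])
  then show ?case
    by (auto simp: HG_def split: if_splits)
qed

text \<open>Both sides obey the same recursion, and the induction hypothesis matches the continuing
  branches term by term.\<close>

lemma pmf_markov_iter_HG:
  fixes \<upsilon> \<tau> :: "'a::finite multiset"
  assumes "(\<upsilon>, \<tau>) \<in> M_gege1" "size \<tau> < CARD('a) + n"
  shows "pmf (markov_iter HG n (\<upsilon>, \<tau>)) (Inr x) = hgff \<upsilon> \<tau> x"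
  using assms
proof (induction n arbitrary: \<upsilon> \<tau>)
  case 0
  then show ?case using size_ge_card[OF 0(1)] by simp
next
  case (Suc n)
  have "pmf (markov_iter HG n (\<upsilon> - {#y#}, \<tau> - {#y#})) (Inr x) = hgff (\<upsilon> - {#y#}) (\<tau> - {#y#}) x"
    if "count \<tau> y > 1" for y
    by (rule Suc.IH[OF markov_iter_HG_step[OF Suc.prems(1) that Suc.prems(2)]])
  then show ?case
    unfolding pmf_markov_iter_HG_Suc[OF Suc.prems(1)] hgff_recursion[OF Suc.prems(1)]
    by simp
qed

theorem theorem9:
  fixes \<upsilon> \<tau> :: "'a::finite multiset" and N L :: nat
  assumes "N = CARD('a)"
    and "\<tau> \<in> M_ge1"
    and "L = size \<tau>"
    and "\<tau> \<subseteq># \<upsilon>"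
  shows "set_pmf (markov_iter HG (L - N + 1) (\<upsilon>, \<tau>)) \<subseteq> range Inr \<and>
    (\<forall>x. pmf (markov_iter HG (L - N + 1) (\<upsilon>, \<tau>)) (Inr x) = hgff \<upsilon> \<tau> x) \<and>
    (\<Sum>x\<in>UNIV. hgff \<upsilon> \<tau> x) = 1"
proof -
  let ?p = "markov_iter HG (L - N + 1) (\<upsilon>, \<tau>)"
  have ge: "(\<upsilon>, \<tau>) \<in> M_gege1"
    using assms(2,4) by (simp add: M_gege1_def M_ge1_def)
  \<comment> \<open>As N \<le> L, the number L - N + 1 is the least \<open>n\<close> with L < N +
    n.\<close>
  have steps: "size \<tau> < CARD('a) + (L - N + 1)"
    using assms(1,3) by simp
  have supp: "set_pmf ?p \<subseteq> range Inr"
    by (rule set_pmf_markov_iter_HG[OF ge steps])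
  have hgff: "pmf ?p (Inr x) = hgff \<upsilon> \<tau> x" for x
    by (rule pmf_markov_iter_HG[OF ge steps])
  \<comment> \<open>The finite set \<open>range Inr\<close> contains the support and hence carries
    the whole mass of \<open>?p\<close>.\<close>
  have "(\<Sum>x\<in>UNIV. hgff \<upsilon> \<tau> x) = (\<Sum>z\<in>range Inr. pmf ?p z)"
    by (simp only: sum.reindex[OF inj_Inr] comp_def hgff)
  also have "\<dots> = 1"
    by (rule sum_pmf_eq_1[OF _ supp]) simp
  finally show ?thesis using supp hgff by blast
qed

end
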